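(* Assume that for each $i$, $J_i$ is continuously differentiable and convex in $x_i$ for given $x_{-i}$, that $\mathcal X$ satisfies Slater's condition, that $G$ has full row rank, and that the communication graph $\mathcal G$ is undirected and connected. Consider the dynamics $$\dot x=-F(x)-G_d^\top\lambda,\qquad \dot z=L\lambda,$$ $$\lambda=\operatorname*{arg\,min}_{\lambda\ge 0}\ \tfrac12\|G_d^\top\lambda\|^2+\lambda^\top\big[G_dF(x)-\alpha(G_dx-H_s)+Lz\big]+\tfrac12\lambda^\top L\lambda .$$ Then for any feasible initial condition $x(0)\in\mathcal X$ and every $\alpha>0$, the variable $\lambda$ satisfies $\lambda\in K_\alpha(x)$, where $$K_\alpha(x)=\big\{\lambda\in\mathbb R^{Nm}_+\ \big|\ G(-F(x)-G_d^\top\lambda)\le-\alpha(Gx-H)\big\},$$ and thus the feasible set $\mathcal X$ is forward invariant, i.e. if $x(0)\in\mathcal X$ then $x(t)\in\mathcal X$ for all $t\ge0$ (for which the solution is defined).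
   Context: There are $N$ players indexed by $\mathcal I=\{1,\dots,N\}$. Player $i$ chooses $x_i\in\mathbb R^{n_i}$; $n=\sum_i n_i$; $x=\mathrm{col}\{x_i\}_{i\in\mathcal I}\in\mathbb R^n$ is the stacked vector and $x_{-i}$ the stacked vector of the decisions of all players other than $i$. Player $i$ has objective $J_i(x_i,x_{-i})$ and local constraint data $g_i\in\mathbb R^{m\times n_i}$, $h_i\in\mathbb R^m$. Put $G=[g_1\ \cdots\ g_N]$, $H=\sum_i h_i$, $\mathcal X=\{x\in\mathbb R^n\mid Gx-H\le 0\}$, $G_d=\mathrm{diag}\{g_i\}_{i\in\mathcal I}$ (block diagonal), $H_s=\mathrm{col}\{h_i\}_{i\in\mathcal I}$, and $F(x)=\mathrm{col}\{\nabla_{x_i}J_i(x_i,x_{-i})\}_{i\in\mathcal I}$. Inequalities between vectors are entrywise. Communication graph: $\mathcal G$ is an undirected weighted graph on $\mathcal I$ with symmetric adjacency matrix $\mathcal A=[a_{ij}]$, $a_{ij}\ge0$, $a_{ii}=0$, $a_{ij}>0$ iff $(i,j)$ is an edge; Laplacian $\mathcal L=\mathrm{diag}\{\mathcal A\mathbf 1_N\}-\mathcal A$; $L=\mathcal L\otimes I_m$. The variables $z=\mathrm{col}\{z_i\}$, $\lambda=\mathrm{col}\{\lambda_i\}$ have $z_i,\lambda_i\in\mathbb R^m$. *)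

theory Defs
  imports "HOL-Analysis.Analysis"
begin

text \<open>
  Players are the elements of a finite type \<open>'i\<close>. To allow a different dimension $n_i$ for every
  player, the coordinates of the stacked vector $x$ are indexed by a finite type \<open>'n\<close> and a map
  \<open>own :: 'n \<Rightarrow> 'i\<close> tells which player a coordinate belongs to: $x_i$ consists of the coordinates
  \<open>k\<close> with \<open>own k = i\<close>, so $n_i$ is the cardinality of that fibre.
  Likewise, $g_i$ consists of the columns \<open>k\<close> of \<open>G :: real^'n^'m\<close> with \<open>own k = i\<close>, so that the
  family $(g_i)_i$ and $G = [g_1 \cdots g_N]$ are the same data.
  Vectors in $\mathbb{R}^{Nm}$ are indexed by \<open>'i \<times> 'm\<close>.
  The order \<open>\<le>\<close> on vectors is the entrywise one.
\<close>

subsection \<open>Objectives and pseudo-gradient\<close>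

text \<open>The vector $(y_i, x_{-i})$; only the block \<open>i\<close> of \<open>y\<close> is used.\<close>

definition with_block :: "('n \<Rightarrow> 'i) \<Rightarrow> 'i \<Rightarrow> real^'n \<Rightarrow> real^'n \<Rightarrow> real^'n" where
  "with_block own i x y = (\<chi> k. if own k = i then y $ k else x $ k)"

definition grad :: "('a::real_inner \<Rightarrow> real) \<Rightarrow> 'a \<Rightarrow> 'a" where
  "grad f x = (THE D. GDERIV f x :> D)"

definition continuously_differentiable :: "('a::real_inner \<Rightarrow> real) \<Rightarrow> bool" where
  "continuously_differentiable f \<longleftrightarrow>
     (\<exists>D. (\<forall>x. GDERIV f x :> D x) \<and> continuous_on UNIV D)"

text \<open>
  The function \<open>\<lambda>y. f (with_block own i x y)\<close> depends on the block $y_i$ alone. Its gradient at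
  \<open>y = x\<close> has $\nabla_{x_i} f(x_i, x_{-i})$ as its block \<open>i\<close> and zeros elsewhere.
\<close>

definition partial_grad ::
    "('n::finite \<Rightarrow> 'i) \<Rightarrow> 'i \<Rightarrow> (real^'n \<Rightarrow> real) \<Rightarrow> real^'n \<Rightarrow> real^'n" where
  "partial_grad own i f x = grad (\<lambda>y. f (with_block own i x y)) x"

definition pseudo_gradient ::
    "('n::finite \<Rightarrow> 'i) \<Rightarrow> ('i \<Rightarrow> real^'n \<Rightarrow> real) \<Rightarrow> real^'n \<Rightarrow> real^'n" where
  "pseudo_gradient own J x = (\<chi> k. partial_grad own (own k) (J (own k)) x $ k)"

subsection \<open>Constraints\<close>

definition total_rhs :: "('i::finite \<Rightarrow> real^'m) \<Rightarrow> real^'m" where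
  "total_rhs h = (\<Sum>i\<in>UNIV. h i)"

definition feasible_set :: "real^'n^'m \<Rightarrow> ('i::finite \<Rightarrow> real^'m) \<Rightarrow> (real^'n) set" where
  "feasible_set G h = {x. G *v x - total_rhs h \<le> 0}"

text \<open>The order \<open><\<close> on vectors is not the entrywise strict one, hence the explicit entries.\<close>

definition slater :: "real^'n^'m \<Rightarrow> ('i::finite \<Rightarrow> real^'m) \<Rightarrow> bool" where
  "slater G h \<longleftrightarrow> (\<exists>x. \<forall>j. (G *v x - total_rhs h) $ j < 0)"

definition block_diag :: "('n \<Rightarrow> 'i::finite) \<Rightarrow> real^'n^'m \<Rightarrow> real^'n^('i \<times> 'm)" where
  "block_diag own G = (\<chi> p k. if own k = fst p then G $ snd p $ k else 0)"

definition stack :: "('i::finite \<Rightarrow> real^'m) \<Rightarrow> real^('i \<times> 'm)" where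
  "stack h = (\<chi> p. h (fst p) $ snd p)"

subsection \<open>Communication graph\<close>

definition undirected_weights :: "real^'i^'i \<Rightarrow> bool" where
  "undirected_weights A \<longleftrightarrow>
     transpose A = A \<and> (\<forall>i j. 0 \<le> A $ i $ j) \<and> (\<forall>i. A $ i $ i = 0)"

definition edges :: "real^'i^'i \<Rightarrow> ('i \<times> 'i) set" where
  "edges A = {(i, j). 0 < A $ i $ j}"

definition connected_graph :: "real^'i^'i \<Rightarrow> bool" where
  "connected_graph A \<longleftrightarrow> (\<forall>i j. (i, j) \<in> (edges A)\<^sup>*)"

definition laplacian :: "real^'i^'i \<Rightarrow> real^'i^'i" where
  "laplacian A = (\<chi> i j. if i = j then (A *v 1) $ i else 0) - A"

definition kronecker :: "real^'j^'i \<Rightarrow> real^'b^'a \<Rightarrow> real^('j \<times> 'b)^('i \<times> 'a)" where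
  "kronecker A B = (\<chi> p q. A $ fst p $ fst q * B $ snd p $ snd q)"

definition laplacian_kron :: "real^'i^'i \<Rightarrow> real^('i \<times> 'm::finite)^('i \<times> 'm)" where
  "laplacian_kron A = kronecker (laplacian A) (mat 1 :: real^'m^'m)"

subsection \<open>Dynamics\<close>

definition qp_objective ::
    "('n::finite \<Rightarrow> 'i::finite) \<Rightarrow> ('i \<Rightarrow> real^'n \<Rightarrow> real) \<Rightarrow> real^'n^'m \<Rightarrow> ('i \<Rightarrow> real^'m) \<Rightarrow>
     real^'i^'i \<Rightarrow> real \<Rightarrow> real^'n \<Rightarrow> real^('i \<times> 'm) \<Rightarrow> real^('i \<times> 'm) \<Rightarrow> real" where
  "qp_objective own J G h A \<alpha> x z l =
     1/2 * (norm (transpose (block_diag own G) *v l))\<^sup>2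
     + l \<bullet> (block_diag own G *v pseudo_gradient own J x
            - \<alpha> *\<^sub>R (block_diag own G *v x - stack h)
            + laplacian_kron A *v z)
     + 1/2 * (l \<bullet> (laplacian_kron A *v l))"

text \<open>
  A solution \<open>(x, z, l)\<close> on a time interval \<open>I\<close>. If \<open>A\<close> is a connected undirected graph and \<open>G\<close> has
  full row rank, the objective is a strictly convex (positive definite) quadratic function of its
  last argument, so the minimizer over the nonnegative orthant exists and is unique.
\<close>

definition solves_dynamics ::
    "('n::finite \<Rightarrow> 'i::finite) \<Rightarrow> ('i \<Rightarrow> real^'n \<Rightarrow> real) \<Rightarrow> real^'n^'m \<Rightarrow> ('i \<Rightarrow> real^'m) \<Rightarrow>
     real^'i^'i \<Rightarrow> real \<Rightarrow> real set \<Rightarrow>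
     (real \<Rightarrow> real^'n) \<Rightarrow> (real \<Rightarrow> real^('i \<times> 'm)) \<Rightarrow> (real \<Rightarrow> real^('i \<times> 'm)) \<Rightarrow> bool" where
  "solves_dynamics own J G h A \<alpha> I x z l \<longleftrightarrow>
     (\<forall>t\<in>I.
        (x has_vector_derivative
           (- pseudo_gradient own J (x t) - transpose (block_diag own G) *v l t)) (at t within I) \<and>
        (z has_vector_derivative (laplacian_kron A *v l t)) (at t within I) \<and>
        l t = arg_min_on (qp_objective own J G h A \<alpha> (x t) (z t)) {v. 0 \<le> v})"

definition K_set ::
    "('n::finite \<Rightarrow> 'i::finite) \<Rightarrow> ('i \<Rightarrow> real^'n \<Rightarrow> real) \<Rightarrow> real^'n^'m \<Rightarrow> ('i \<Rightarrow> real^'m) \<Rightarrow>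
     real \<Rightarrow> real^'n \<Rightarrow> (real^('i \<times> 'm)) set" where
  "K_set own J G h \<alpha> x =
     {l. 0 \<le> l \<and>
         G *v (- pseudo_gradient own J x - transpose (block_diag own G) *v l)
           \<le> - (\<alpha> *\<^sub>R (G *v x - total_rhs h))}"

end

theory Submission
  imports Defs
begin

text \<open>
  Testing the optimality of \<open>\<lambda>\<close> along the consensus directions \<open>\<one> \<otimes> e\<^sub>j\<close>, which lie in the nonnegative
  orthant and in the kernel of the Laplacian, yields exactly the \<open>m\<close> inequalities that define \<open>K\<^sub>\<alpha>(x)\<close>.
  Connectivity and full row rank are used only to know that the minimizer exists: they make the
  quadratic form positive definite. Forward invariance then follows from Gronwall's inequality
  applied to the entries of \<open>G x - H\<close>.
\<close>

subsection \<open>Minimization of quadratic functions\<close>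

text \<open>By homogeneity and compactness of the unit sphere, \<open>q v\<close> is at least a
  positive multiple of \<open>(norm v)\<^sup>2\<close>. Far from the origin it dominates the linear
  term, so the total is nonnegative there, while it is 0 at the origin. Minimizing over a compact
  piece of \<open>S\<close> is therefore enough.\<close>

lemma quadratic_attains_min:
  fixes q :: "'a::euclidean_space \<Rightarrow> real"
  assumes cont: "continuous_on UNIV q"
    and hom: "\<And>s v. q (s *\<^sub>R v) = s\<^sup>2 * q v"
    and pos: "\<And>v. v \<noteq> 0 \<Longrightarrow> q v > 0"
    and S: "closed S" "0 \<in> S"
  obtains v where "v \<in> S" "\<And>w. w \<in> S \<Longrightarrow> q v + v \<bullet> c \<le> q w + w \<bullet> c"
proof -
  obtain \<mu> where \<mu>: "\<mu> > 0" "\<And>v. q v \<ge> \<mu> * (norm v)\<^sup>2"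
  proof -
    have ne: "sphere (0::'a) 1 \<noteq> {}" by (simp add: sphere_eq_empty)
    obtain u where u: "u \<in> sphere 0 1" "\<And>v. v \<in> sphere 0 1 \<Longrightarrow> q u \<le> q v"
      using continuous_attains_inf[OF compact_sphere ne] continuous_on_subset[OF cont] by blast
    have "q v \<ge> q u * (norm v)\<^sup>2" for v
    proof (cases "v = 0")
      case True
      then show ?thesis using hom[of 0 v] by simp
    next
      case False
      then have "q u \<le> q (inverse (norm v) *\<^sub>R v)" by (intro u(2)) simp
      then show ?thesis using False by (simp add: hom field_simps)
    qed
    moreover have "q u > 0" using u(1) by (intro pos) auto
    ultimately show ?thesis using that by blast
  qed
  \<comment> \<open>Outside this ball \<open>\<mu> * (norm w)\<^sup>2\<close> is at least
    \<open>norm w * norm c\<close>, which bounds the linear term by Cauchy-Schwarz.\<close>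
  define R where "R = norm c / \<mu>"
  have "compact (S \<inter> cball 0 R)" using S(1) by (simp add: closed_Int_compact)
  moreover have "S \<inter> cball 0 R \<noteq> {}" using S(2) \<mu>(1) by (auto simp: R_def)
  moreover have "continuous_on (S \<inter> cball 0 R) (\<lambda>v. q v + v \<bullet> c)"
    by (intro continuous_intros continuous_on_subset[OF cont]) auto
  ultimately obtain v where v: "v \<in> S" "\<And>w. w \<in> S \<inter> cball 0 R \<Longrightarrow> q v + v \<bullet> c \<le> q w + w \<bullet> c"
    using continuous_attains_inf[of "S \<inter> cball 0 R" "\<lambda>v. q v + v \<bullet> c"] by blast
  have "q v + v \<bullet> c \<le> q w + w \<bullet> c" if "w \<in> S" for w
  proof (cases "w \<in> cball 0 R")
    case True
    then show ?thesis using v that by blast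
  next
    case False
    then have "norm c \<le> \<mu> * norm w" using \<mu>(1) by (simp add: R_def field_simps)
    then have "norm w * norm c \<le> \<mu> * (norm w)\<^sup>2"
      using mult_left_mono[of "norm c" "\<mu> * norm w" "norm w"]
      by (simp add: power2_eq_square algebra_simps)
    also have "\<dots> \<le> q w" by (rule \<mu>(2))
    finally have "0 \<le> q w + w \<bullet> c" using Cauchy_Schwarz_ineq2[of w c] by linarith
    moreover have "q v + v \<bullet> c \<le> q 0 + 0 \<bullet> c"
      using S(2) \<mu>(1) by (intro v(2)) (auto simp: R_def)
    moreover have "q 0 = 0" using hom[of 0 0] by simp
    ultimately show ?thesis by simp
  qed
  with v(1) show ?thesis using that by blast
qed

lemma nonneg_of_affine_nonneg:
  fixes a b :: real
  assumes "\<And>s. s > 0 \<Longrightarrow> 0 \<le> a + s * b"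
  shows "0 \<le> a"
proof (rule tendsto_lowerbound)
  show "((\<lambda>s. a + s * b) \<longlongrightarrow> a) (at_right 0)"
    by (auto intro!: tendsto_eq_intros)
  show "\<forall>\<^sub>F s in at_right 0. 0 \<le> a + s * b"
    using assms by (auto simp: eventually_at_filter)
qed simp

lemma inner_transpose_matrix_vector:
  fixes B :: "real^'n^'m"
  shows "v \<bullet> (B *v u) = u \<bullet> (transpose B *v v)"
  by (metis dot_lmul_matrix inner_commute transpose_matrix_vector)

text \<open>The increment of \<open>Q\<close> along \<open>v\<close>, divided by the step
  \<open>s\<close>, is exactly affine in \<open>s\<close>: the constant term is the directional
  derivative, the slope half the quadratic form at \<open>v\<close>. Letting \<open>s\<close> tend
  to 0 leaves the directional derivative.\<close>

lemma quadratic_min_first_order: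
  fixes B :: "real^'n^'p" and L :: "real^'p^'p" and c l v :: "real^'p"
  defines "Q \<equiv> \<lambda>l. 1/2 * (norm (transpose B *v l))\<^sup>2 + l \<bullet> c + 1/2 * (l \<bullet> (L *v l))"
  assumes sym: "\<And>u w. u \<bullet> (L *v w) = w \<bullet> (L *v u)"
    and min: "\<And>s. s > 0 \<Longrightarrow> Q l \<le> Q (l + s *\<^sub>R v)"
  shows "0 \<le> v \<bullet> (B *v (transpose B *v l) + c + L *v l)"
proof (rule nonneg_of_affine_nonneg)
  fix s :: real
  assume s: "s > 0"
  let ?q = "(norm (transpose B *v v))\<^sup>2 / 2 + v \<bullet> (L *v v) / 2"
  \<comment> \<open>Symmetry of \<open>L\<close> merges the two cross terms in \<open>l\<close> and
    \<open>v\<close>.\<close>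
  have "Q (l + s *\<^sub>R v) - Q l = s * (v \<bullet> (B *v (transpose B *v l) + c + L *v l) + s * ?q)"
    unfolding Q_def inner_add_right inner_transpose_matrix_vector[of v B] power2_norm_eq_inner
    using sym[of v l]
    by (simp add: matrix_vector_right_distrib matrix_vector_mult_scaleR inner_add_left
        inner_add_right inner_commute[of "v v* B" "l v* B"] field_simps power2_eq_square)
  then show "0 \<le> v \<bullet> (B *v (transpose B *v l) + c + L *v l) + s * ?q"
    using min[OF s] s by (metis diff_ge_0_iff_ge zero_le_mult_iff not_less)
qed

subsection \<open>The Laplacian\<close>

lemma sum_prod_UNIV:
  fixes f :: "'a::finite \<times> 'b::finite \<Rightarrow> real"
  shows "(\<Sum>p\<in>UNIV. f p) = (\<Sum>i\<in>UNIV. \<Sum>k\<in>UNIV. f (i, k))"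
  by (simp add: sum.cartesian_product)

text \<open>The identity factor makes the matrix act on each coordinate \<open>k\<close> separately;
  the weighted degree on the diagonal supplies the term \<open>v $ (i, k)\<close> of each
  difference.\<close>

lemma laplacian_kron_nth:
  fixes A :: "real^'i^'i" and v :: "real^('i \<times> 'm::finite)"
  shows "(laplacian_kron A *v v) $ (i, k) = (\<Sum>j\<in>UNIV. A $ i $ j * (v $ (i, k) - v $ (j, k)))"
proof -
  have "(laplacian_kron A *v v) $ (i, k) = (\<Sum>j\<in>UNIV. laplacian A $ i $ j * v $ (j, k))"
    unfolding laplacian_kron_def kronecker_def matrix_vector_mult_def
    by (simp add: sum_prod_UNIV mat_def if_distrib if_distribR cong: if_cong)
  also have "\<dots> = (\<Sum>j\<in>UNIV. (if i = j then (A *v 1) $ i * v $ (j, k) else 0) - A $ i $ j * v $ (j, k))"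
    by (intro sum.cong) (auto simp: laplacian_def algebra_simps)
  also have "\<dots> = (\<Sum>j\<in>UNIV. A $ i $ j * (v $ (i, k) - v $ (j, k)))"
    by (simp add: sum_subtractf matrix_vector_mult_def right_diff_distrib sum_distrib_right)
  finally show ?thesis .
qed

text \<open>This is the Dirichlet form of the graph, obtained by averaging the double sum with its
  copy in which \<open>i\<close> and \<open>j\<close> are exchanged. Symmetry, semidefiniteness and
  the kernel are all read off from it.\<close>

lemma inner_laplacian_kron:
  fixes A :: "real^'i^'i" and u v :: "real^('i \<times> 'm::finite)"
  assumes "undirected_weights A"
  shows "u \<bullet> (laplacian_kron A *v v) =
    (\<Sum>i\<in>UNIV. \<Sum>j\<in>UNIV. \<Sum>k\<in>UNIV.
       A $ i $ j * ((u $ (i, k) - u $ (j, k)) * (v $ (i, k) - v $ (j, k)))) / 2"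
proof -
  let ?f = "\<lambda>i j. \<Sum>k\<in>UNIV. A $ i $ j * (u $ (i, k) * (v $ (i, k) - v $ (j, k)))"
  have A: "A $ j $ i = A $ i $ j" for i j
  proof -
    have "A $ j $ i = transpose A $ i $ j" by (simp add: transpose_def)
    then show ?thesis using assms by (simp add: undirected_weights_def)
  qed
  have "u \<bullet> (laplacian_kron A *v v) =
      (\<Sum>i\<in>UNIV. \<Sum>k\<in>UNIV. \<Sum>j\<in>UNIV. A $ i $ j * (u $ (i, k) * (v $ (i, k) - v $ (j, k))))"
    by (simp add: inner_vec_def sum_prod_UNIV laplacian_kron_nth sum_distrib_left mult_ac)
  also have "\<dots> = (\<Sum>i\<in>UNIV. \<Sum>j\<in>UNIV. ?f i j)"
    by (rule sum.cong[OF refl sum.swap])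
  finally have e1: "u \<bullet> (laplacian_kron A *v v) = (\<Sum>i\<in>UNIV. \<Sum>j\<in>UNIV. ?f i j)" .
  then have e2: "u \<bullet> (laplacian_kron A *v v) = (\<Sum>i\<in>UNIV. \<Sum>j\<in>UNIV. ?f j i)"
    using sum.swap[of ?f UNIV UNIV] by simp
  have "2 * (u \<bullet> (laplacian_kron A *v v)) = (\<Sum>i\<in>UNIV. \<Sum>j\<in>UNIV. ?f i j + ?f j i)"
    using e1 e2 by (simp add: sum.distrib)
  also have "\<dots> = (\<Sum>i\<in>UNIV. \<Sum>j\<in>UNIV. \<Sum>k\<in>UNIV.
       A $ i $ j * ((u $ (i, k) - u $ (j, k)) * (v $ (i, k) - v $ (j, k))))"
    by (simp add: A sum.distrib[symmetric] algebra_simps)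
  finally show ?thesis by simp
qed

lemma laplacian_kron_commute:
  assumes "undirected_weights A"
  shows "u \<bullet> (laplacian_kron A *v v) = v \<bullet> (laplacian_kron A *v u)"
  unfolding inner_laplacian_kron[OF assms] by (simp add: mult.commute)

lemma laplacian_kron_nonneg:
  assumes "undirected_weights A"
  shows "0 \<le> v \<bullet> (laplacian_kron A *v v)"
  unfolding inner_laplacian_kron[OF assms] using assms
  by (auto simp: undirected_weights_def intro!: sum_nonneg)

text \<open>A vanishing sum of nonnegative edge energies forces each to vanish, so \<open>v\<close>
  agrees across every edge; connectivity carries this along paths.\<close>

lemma laplacian_kron_eq_0_imp_consensus:
  assumes U: "undirected_weights A" and "connected_graph A"
    and z: "v \<bullet> (laplacian_kron A *v v) = 0"
  shows "v $ (i, k) = v $ (j, k)"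
proof -
  have A0: "0 \<le> A $ i $ j" for i j using U by (simp add: undirected_weights_def)
  have "(\<Sum>i\<in>UNIV. \<Sum>j\<in>UNIV. \<Sum>k\<in>UNIV. A $ i $ j * (v $ (i, k) - v $ (j, k))\<^sup>2) = 0"
    using z unfolding inner_laplacian_kron[OF U] by (simp add: power2_eq_square)
  then have "A $ i $ j * (v $ (i, k) - v $ (j, k))\<^sup>2 = 0" for i j k
    by (auto simp: sum_nonneg_eq_0_iff sum_nonneg A0)
  then have edge: "v $ (i, k) = v $ (j, k)" if "(i, j) \<in> edges A" for i j k
  proof -
    have "A $ i $ j > 0" using that by (simp add: edges_def)
    then show ?thesis using \<open>A $ i $ j * (v $ (i, k) - v $ (j, k))\<^sup>2 = 0\<close> by simp
  qed
  have "(i, j) \<in> (edges A)\<^sup>*" using assms(2) by (simp add: connected_graph_def)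
  then show ?thesis by (induction rule: rtrancl_induct) (auto simp: edge)
qed

subsection \<open>Consensus vectors\<close>

text \<open>The vector \<open>\<one> \<otimes> y\<close>.\<close>

definition consensus :: "real^'m \<Rightarrow> real^('i::finite \<times> 'm)" where
  "consensus y = (\<chi> p. y $ snd p)"

text \<open>All differences of a consensus vector vanish. This is what removes \<open>z\<close> and
  the Laplacian coupling from the optimality condition.\<close>

lemma consensus_laplacian_kron:
  assumes "undirected_weights A"
  shows "consensus y \<bullet> (laplacian_kron A *v v) = 0"
  unfolding inner_laplacian_kron[OF assms] by (simp add: consensus_def)

text \<open>Each column belongs to exactly one player, so summing the block rows over all players
  recovers \<open>G\<close>.\<close>

lemma consensus_inner_block_diag:
  fixes own :: "'n::finite \<Rightarrow> 'i::finite"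
  shows "consensus y \<bullet> (block_diag own G *v w) = y \<bullet> (G *v w)"
proof -
  have "consensus y \<bullet> (block_diag own G *v w) =
      (\<Sum>i\<in>UNIV. \<Sum>k\<in>UNIV. \<Sum>n\<in>UNIV. if own n = i then y $ k * (G $ k $ n * w $ n) else 0)"
    by (simp add: consensus_def inner_vec_def sum_prod_UNIV block_diag_def matrix_vector_mult_def
        sum_distrib_left if_distrib if_distribR cong: if_cong)
  also have "\<dots> = (\<Sum>k\<in>UNIV. \<Sum>n\<in>UNIV. \<Sum>i\<in>UNIV. if own n = i then y $ k * (G $ k $ n * w $ n) else 0)"
    by (subst sum.swap) (rule sum.cong[OF refl sum.swap])
  also have "\<dots> = y \<bullet> (G *v w)"
    by (simp add: inner_vec_def matrix_vector_mult_def sum_distrib_left)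
  finally show ?thesis .
qed

lemma consensus_inner_stack: "consensus y \<bullet> stack h = y \<bullet> total_rhs h"
proof -
  have "consensus y \<bullet> stack h = (\<Sum>i\<in>UNIV. y \<bullet> h i)"
    by (simp add: consensus_def stack_def inner_vec_def sum_prod_UNIV)
  then show ?thesis by (simp add: total_rhs_def inner_sum_right)
qed

text \<open>The adjoint form of \<open>consensus_inner_block_diag\<close>.\<close>

lemma transpose_block_diag_consensus:
  fixes own :: "'n::finite \<Rightarrow> 'i::finite"
  shows "transpose (block_diag own G) *v consensus y = transpose G *v y"
proof (rule vector_eq_ldot[THEN iffD1], rule allI)
  fix w
  show "w \<bullet> (transpose (block_diag own G) *v consensus y) = w \<bullet> (transpose G *v y)"
    by (simp only: consensus_inner_block_diag inner_transpose_matrix_vector[symmetric])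
qed

subsection \<open>Optimality\<close>

text \<open>If both nonnegative terms vanish, the second makes \<open>v\<close> a consensus vector
  of some \<open>y\<close>. The first then says that \<open>transpose G\<close> annihilates
  \<open>y\<close>, and full row rank gives \<open>y = 0\<close>.\<close>

lemma qp_form_positive_definite:
  fixes own :: "'n::finite \<Rightarrow> 'i::finite" and G :: "real^'n^'m"
  assumes rk: "rank G = CARD('m)" and A: "undirected_weights A" "connected_graph A"
    and "v \<noteq> 0"
  shows "(norm (transpose (block_diag own G) *v v))\<^sup>2 + v \<bullet> (laplacian_kron A *v v) > 0"
proof (rule ccontr)
  assume "\<not> ?thesis"
  moreover have "0 \<le> v \<bullet> (laplacian_kron A *v v)" by (rule laplacian_kron_nonneg[OF A(1)])
  moreover have "0 \<le> (norm (transpose (block_diag own G) *v v))\<^sup>2" by (rule zero_le_power2)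
  ultimately have "(norm (transpose (block_diag own G) *v v))\<^sup>2 = 0"
    and z2: "v \<bullet> (laplacian_kron A *v v) = 0" by linarith+
  then have z1: "transpose (block_diag own G) *v v = 0"
    by (simp only: zero_eq_power2 norm_eq_zero)
  \<comment> \<open>Here \<open>undefined\<close> is just an arbitrary player, since all blocks of
    \<open>v\<close> coincide.\<close>
  define y where "y = (\<chi> k. v $ (undefined, k))"
  have v: "v = consensus y"
    using laplacian_kron_eq_0_imp_consensus[OF A z2] by (auto simp: vec_eq_iff consensus_def y_def)
  have "transpose G *v y = transpose G *v 0"
    using z1 by (simp only: v transpose_block_diag_consensus matrix_vector_mult_0_right)
  moreover have "inj ((*v) (transpose G))"
    using rk by (simp add: full_rank_injective[symmetric] rank_transpose)
  ultimately have "y = 0" by (metis injD)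
  with v \<open>v \<noteq> 0\<close> show False by (simp add: consensus_def vec_eq_iff)
qed

text \<open>\<open>arg_min_on\<close> is a choice operator, so its value has the minimizing property
  only once some minimizer is exhibited; positive definiteness provides one.\<close>

lemma qp_minimizer:
  fixes own :: "'n::finite \<Rightarrow> 'i::finite" and G :: "real^'n^'m"
    and J :: "'i \<Rightarrow> real^'n \<Rightarrow> real" and h :: "'i \<Rightarrow> real^'m"
    and A :: "real^'i^'i" and \<alpha> :: real and x :: "real^'n" and z :: "real^('i \<times> 'm)"
  assumes "rank G = CARD('m)" and A: "undirected_weights A" "connected_graph A"
  defines "l \<equiv> arg_min_on (qp_objective own J G h A \<alpha> x z) {v. 0 \<le> v}"
  shows "0 \<le> l"
    and "0 \<le> v \<Longrightarrow> qp_objective own J G h A \<alpha> x z l \<le> qp_objective own J G h A \<alpha> x z v"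
proof -
  let ?Q = "qp_objective own J G h A \<alpha> x z" and ?B = "block_diag own G" and ?L = "laplacian_kron A"
  let ?q = "\<lambda>v. 1/2 * ((norm (transpose ?B *v v))\<^sup>2 + v \<bullet> (?L *v v))"
  let ?c = "?B *v pseudo_gradient own J x - \<alpha> *\<^sub>R (?B *v x - stack h) + ?L *v z"
  have "continuous_on UNIV ?q"
    by (intro continuous_intros linear_continuous_on matrix_vector_mul_bounded_linear)
  moreover have "?q (s *\<^sub>R v) = s\<^sup>2 * ?q v" for s v
    by (simp add: matrix_vector_mult_scaleR power_mult_distrib algebra_simps power2_eq_square)
  moreover have "?q v > 0" if "v \<noteq> 0" for v
    using qp_form_positive_definite[OF assms(1) A that, of own] by simp
  moreover have "closed {v::real^('i \<times> 'm). 0 \<le> v}"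
    using closed_eucl_atLeast[of "0::real^('i \<times> 'm)"] by (simp add: atLeast_def)
  ultimately obtain u where u: "u \<in> {v. 0 \<le> v}"
    "\<And>w. w \<in> {v. 0 \<le> v} \<Longrightarrow> ?q u + u \<bullet> ?c \<le> ?q w + w \<bullet> ?c"
    by (rule quadratic_attains_min[where c = ?c]) auto
  moreover have "?Q v = ?q v + v \<bullet> ?c" for v
    by (simp add: qp_objective_def field_simps)
  ultimately have "is_arg_min ?Q (\<lambda>v. v \<in> {v. 0 \<le> v}) u"
    unfolding is_arg_min_linorder by simp
  then have "is_arg_min ?Q (\<lambda>v. v \<in> {v. 0 \<le> v}) l"
    unfolding l_def arg_min_on_def arg_min_def by (rule someI)
  then show "0 \<le> l" and "0 \<le> v \<Longrightarrow> ?Q l \<le> ?Q v"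
    by (simp_all add: is_arg_min_linorder)
qed

lemma qp_minimizer_in_K_set:
  fixes own :: "'n::finite \<Rightarrow> 'i::finite" and G :: "real^'n^'m"
  assumes "rank G = CARD('m)" and A: "undirected_weights A" "connected_graph A"
  shows "arg_min_on (qp_objective own J G h A \<alpha> x z) {v. 0 \<le> v} \<in> K_set own J G h \<alpha> x"
proof -
  let ?l = "arg_min_on (qp_objective own J G h A \<alpha> x z) {v. 0 \<le> v}"
  let ?B = "block_diag own G" and ?L = "laplacian_kron A" and ?F = "pseudo_gradient own J x"
  note l = qp_minimizer[OF assms, where own = own and J = J and h = h and \<alpha> = \<alpha> and x = x and z = z]
  have "(G *v (- ?F - transpose ?B *v ?l)) $ j \<le> (- (\<alpha> *\<^sub>R (G *v x - total_rhs h))) $ j" for j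
  proof -
    define e where "e = (axis j 1 :: real^'m)"
    have e: "e \<bullet> w = w $ j" for w
      by (simp add: e_def inner_axis')
    have "0 \<le> (consensus e :: real^('i \<times> 'm))"
      by (simp add: less_eq_vec_def consensus_def e_def axis_def)
    \<comment> \<open>The whole ray stays in the orthant, so every step size \<open>s > 0\<close>
      yields a competitor.\<close>
    then have "0 \<le> ?l + s *\<^sub>R consensus e" if "s > 0" for s :: real
      using l(1) that by (simp add: scaleR_nonneg_nonneg)
    from l(2)[OF this] have "0 \<le> consensus e \<bullet> (?B *v (transpose ?B *v ?l) +
        (?B *v ?F - \<alpha> *\<^sub>R (?B *v x - stack h) + ?L *v z) + ?L *v ?l)"
      unfolding qp_objective_def
      by (intro quadratic_min_first_order laplacian_kron_commute[OF A(1)])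
    \<comment> \<open>Pairing with a consensus vector kills both Laplacian terms and collapses
      \<open>block_diag own G\<close> to \<open>G\<close> and \<open>stack h\<close> to
      \<open>total_rhs h\<close>.\<close>
    also have "\<dots> = e \<bullet> (G *v (transpose ?B *v ?l) + G *v ?F - \<alpha> *\<^sub>R (G *v x - total_rhs h))"
      by (simp add: inner_add_right inner_diff_right consensus_inner_block_diag
          consensus_inner_stack consensus_laplacian_kron[OF A(1)])
    finally show ?thesis
      by (simp add: e matrix_vector_mult_diff_distrib linear_neg[OF matrix_vector_mul_linear] algebra_simps)
  qed
  with l(1) show ?thesis by (simp add: K_set_def less_eq_vec_def)
qed

subsection \<open>Forward invariance\<close>

text \<open>The integrating factor \<open>exp (\<alpha> * s)\<close> turns the differential
  inequality into monotonicity of the weighted function, and its positivity preserves signs.\<close>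

lemma gronwall_nonpos:
  fixes y y' :: "real \<Rightarrow> real"
  assumes I: "is_interval I" "a \<in> I" "t \<in> I" "a \<le> t"
    and deriv: "\<And>s. s \<in> I \<Longrightarrow> (y has_real_derivative y' s) (at s within I)"
    and le: "\<And>s. s \<in> I \<Longrightarrow> y' s \<le> - \<alpha> * y s"
    and init: "y a \<le> 0"
  shows "y t \<le> 0"
proof -
  let ?w = "\<lambda>s. exp (\<alpha> * s) * y s"
  have sub: "{a..t} \<subseteq> I"
    using interval_subset_is_interval[OF I(1), of a t] I by simp
  have w: "(?w has_real_derivative exp (\<alpha> * s) * (y' s + \<alpha> * y s)) (at s within {a..t})"
    if "s \<in> {a..t}" for s
  proof -
    have "(y has_real_derivative y' s) (at s within {a..t})"
      using that sub deriv by (blast intro: DERIV_subset)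
    then show ?thesis
      by (auto intro!: derivative_eq_intros simp: algebra_simps)
  qed
  have "?w t \<le> ?w a"
  \<comment> \<open>At the endpoints only one-sided derivatives are available, so the argument uses
    continuity on the closed interval and two-sided derivatives inside.\<close>
  proof (rule DERIV_nonpos_imp_decreasing_open[OF \<open>a \<le> t\<close>])
    show "continuous_on {a..t} ?w"
      by (rule DERIV_continuous_on) (rule w)
    fix s assume s: "a < s" "s < t"
    then have "(?w has_real_derivative exp (\<alpha> * s) * (y' s + \<alpha> * y s)) (at s)"
      using w[of s] by (simp add: at_within_Icc_at)
    moreover have "exp (\<alpha> * s) * (y' s + \<alpha> * y s) \<le> 0"
    proof (rule mult_nonneg_nonpos)
      have "s \<in> I" using s sub by auto
      from le[OF this] show "y' s + \<alpha> * y s \<le> 0" by simp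
    qed simp
    ultimately show "\<exists>d. (?w has_real_derivative d) (at s) \<and> d \<le> 0" by blast
  qed
  also have "?w a \<le> 0" using init by (simp add: mult_nonneg_nonpos)
  finally show ?thesis by (simp add: mult_le_0_iff)
qed

theorem lemma3p4:
  fixes own :: "'n::finite \<Rightarrow> 'i::finite"
    and J :: "'i \<Rightarrow> real^'n \<Rightarrow> real"
    and G :: "real^'n^'m"
    and h :: "'i \<Rightarrow> real^'m"
    and A :: "real^'i^'i"
    and \<alpha> :: real
    and I :: "real set"
    and x :: "real \<Rightarrow> real^'n"
    and z l :: "real \<Rightarrow> real^('i \<times> 'm)"
  assumes J_C1: "\<And>i w. continuously_differentiable (\<lambda>y. J i (with_block own i w y))"
    and J_convex: "\<And>i w. convex_on UNIV (\<lambda>y. J i (with_block own i w y))"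
    and slater: "slater G h"
    and full_row_rank: "rank G = CARD('m)"
    and undirected: "undirected_weights A"
    and connected: "connected_graph A"
    and \<alpha>_pos: "\<alpha> > 0"
    and interval: "is_interval I" "0 \<in> I" "I \<subseteq> {0..}"
    and solution: "solves_dynamics own J G h A \<alpha> I x z l"
    and initial: "x 0 \<in> feasible_set G h"
  shows "(\<forall>t\<in>I. l t \<in> K_set own J G h \<alpha> (x t)) \<and> (\<forall>t\<in>I. x t \<in> feasible_set G h)"
proof -
  have K: "l t \<in> K_set own J G h \<alpha> (x t)" if "t \<in> I" for t
    using solution that qp_minimizer_in_K_set[OF full_row_rank undirected connected]
    unfolding solves_dynamics_def by metis
  have "x t \<in> feasible_set G h" if t: "t \<in> I" for t
  proof -
    have "(G *v x t - total_rhs h) $ j \<le> 0" for j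
    proof (rule gronwall_nonpos[OF interval(1,2) t])
      let ?x' = "\<lambda>s. - pseudo_gradient own J (x s) - transpose (block_diag own G) *v l s"
      show "0 \<le> t" using interval(3) t by auto
      fix s assume s: "s \<in> I"
      have "(x has_vector_derivative ?x' s) (at s within I)"
        using solution s unfolding solves_dynamics_def by blast
      then have "((\<lambda>s. G *v x s) has_vector_derivative G *v ?x' s) (at s within I)"
        by (rule bounded_linear.has_vector_derivative[OF matrix_vector_mul_bounded_linear])
      then have "((\<lambda>s. (G *v x s) $ j) has_vector_derivative (G *v ?x' s) $ j) (at s within I)"
        by (rule bounded_linear.has_vector_derivative[OF bounded_linear_vec_nth])
      then show "((\<lambda>s. (G *v x s - total_rhs h) $ j) has_real_derivative (G *v ?x' s) $ j)
          (at s within I)"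
        unfolding has_real_derivative_iff_has_vector_derivative
        by (auto intro!: derivative_eq_intros)
      \<comment> \<open>This is row \<open>j\<close> of the inequality in \<open>K_set\<close>, read
        along the velocity \<open>?x' s\<close>.\<close>
      show "(G *v ?x' s) $ j \<le> - \<alpha> * (G *v x s - total_rhs h) $ j"
        using K[OF s] by (simp add: K_set_def less_eq_vec_def)
    next
      show "(G *v x 0 - total_rhs h) $ j \<le> 0"
        using initial by (simp add: feasible_set_def less_eq_vec_def)
    qed
    then show ?thesis by (simp add: feasible_set_def less_eq_vec_def)
  qed
  with K show ?thesis by blast
qed

end
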